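(* Let $n,N\in\mathbb{N}$ with $n>1$, let $\alpha,\varepsilon>0$, let $\bm{C}\in\mathbb{R}^{N\times N}$ be the squared Euclidean distance matrix of points $\bm{\theta}_1,\dots,\bm{\theta}_N\in\mathbb{R}^d$, i.e. $\bm{C}(r,s)=\|\bm{\theta}_r-\bm{\theta}_s\|_2^2$, and let $\bm{\Gamma}:=\exp(-\bm{C}/2\varepsilon)$ (elementwise exponential). Let $\bm{\mu}_1,\dots,\bm{\mu}_n\in\Delta^{N-1}$ be probability vectors and let $\bm{\nu}_{\rm sum}\in\mathbb{R}^N$. Let $$(\bm{u}_1^{\rm opt},\dots,\bm{u}_n^{\rm opt})\in\underset{(\bm{u}_1,\dots,\bm{u}_n)\in\mathbb{R}^{nN}}{\arg\min}\ \sum_{i=1}^n\big\langle\bm{\mu}_i,\log\left(\bm{\Gamma}\exp(\bm{u}_i/\varepsilon)\right)\big\rangle\quad\text{subject to}\quad\sum_{i=1}^n\bm{u}_i=\frac{2}{\alpha}\bm{\nu}_{\rm sum}.$$ Then the minimizer $$\bm{\zeta}^{+}=\underset{\bm{\zeta}\in\Delta^{N-1}}{\arg\inf}\left\{\left(\sum_{i=1}^n\ \min_{\bm{M}_i\in\Pi_N(\bm{\mu}_i,\bm{\zeta})}\Big\langle\tfrac12\bm{C}+\varepsilon\log\bm{M}_i,\bm{M}_i\Big\rangle\right)-\frac{2}{\alpha}\langle\bm{\nu}_{\rm sum},\bm{\zeta}\rangle\right\}$$ is given by $$\bm{\zeta}^{+}=\exp(\bm{u}_i^{\rm opt}/\varepsilon)\odot\Big(\bm{\Gamma}\big(\bm{\mu}_i\oslash(\bm{\Gamma}\exp(\bm{u}_i^{\rm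 opt}/\varepsilon))\big)\Big)\in\Delta^{N-1}\quad\text{for all } i\in\{1,\dots,n\}.$$
   Context: $\Delta^{N-1}:=\{\bm{x}\in\mathbb{R}^N: \bm{x}\ge\bm{0},\ \bm{1}^\top\bm{x}=1\}$ is the probability simplex. For $\bm{\xi},\bm{\eta}\in\Delta^{N-1}$, $\Pi_N(\bm{\xi},\bm{\eta}):=\{\bm{M}\in\mathbb{R}^{N\times N}: \bm{M}\ge\bm{0}\text{ elementwise},\ \bm{M}\bm{1}=\bm{\xi},\ \bm{M}^\top\bm{1}=\bm{\eta}\}$. $\exp$ and $\log$ of vectors and matrices are elementwise, with the convention $0\log 0=0$; $\odot$ and $\oslash$ are elementwise multiplication and division; $\langle\cdot,\cdot\rangle$ is the standard (Frobenius) inner product. In the paper's algorithm, $\bm{\mu}_i$ is the $i$-th outer iterate $\bm{\mu}_i^{k+1}$, $\bm{\nu}_{\rm sum}$ is the sum $\bm{\nu}_{\rm sum}^k$ of the $n$ Lagrange multiplier vectors at iteration $k$, and $\bm{\zeta}^{+}$ is the consensus update $\bm{\zeta}^{k+1}$; the outer iteration index $k$ is fixed throughout. *)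

theory Defs
  imports "HOL-Analysis.Analysis"
begin

text \<open>
  On \<^typ>\<open>real ^ 'N\<close> and \<^typ>\<open>real ^ 'N ^ 'N\<close> the library already provides the entrywise
  order \<open>\<le>\<close>, the all-ones vector \<open>1 :: real ^ 'N\<close>, the entrywise product \<open>*\<close> and, as
  \<open>\<bullet>\<close>, the standard (for matrices: Frobenius) inner product.
\<close>

definition map_vec :: "('a \<Rightarrow> 'b) \<Rightarrow> 'a ^ 'N \<Rightarrow> 'b ^ 'N"
  where "map_vec f x = (\<chi> i. f (x $ i))"

abbreviation vec_times :: "real ^ 'N \<Rightarrow> real ^ 'N \<Rightarrow> real ^ 'N"  (infixl "\<odot>" 70)
  where "x \<odot> y \<equiv> x * y"

definition vec_divide :: "real ^ 'N \<Rightarrow> real ^ 'N \<Rightarrow> real ^ 'N"  (infixl "\<oslash>" 70)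
  where "x \<oslash> y = (\<chi> i. x $ i / y $ i)"

definition prob_simplex :: "(real ^ 'N) set"
  where "prob_simplex = {x. 0 \<le> x \<and> 1 \<bullet> x = 1}"

definition couplings :: "real ^ 'N \<Rightarrow> real ^ 'N \<Rightarrow> (real ^ 'N ^ 'N) set"
  where "couplings \<xi> \<eta> = {M. 0 \<le> M \<and> M *v 1 = \<xi> \<and> transpose M *v 1 = \<eta>}"

definition sq_dist_matrix :: "('N \<Rightarrow> real ^ 'd) \<Rightarrow> real ^ 'N ^ 'N"
  where "sq_dist_matrix \<theta> = (\<chi> r s. (norm (\<theta> r - \<theta> s))\<^sup>2)"

text \<open>
  The value of an attained minimum; \<open>LEAST\<close>, unlike \<open>Inf\<close>, only has this value specified
  when the minimum is attained.
\<close>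

definition min_over :: "'a set \<Rightarrow> ('a \<Rightarrow> real) \<Rightarrow> real"
  where "min_over S f = (LEAST v. v \<in> f ` S)"

text \<open>
  The convention \<open>0 log 0 = 0\<close> holds automatically, because the entrywise logarithm of \<open>M\<close> is
  multiplied entrywise by \<open>M\<close> in the inner product and \<open>x * 0 = 0\<close>.
\<close>

definition entropic_ot :: "real ^ 'N ^ 'N \<Rightarrow> real \<Rightarrow> real ^ 'N \<Rightarrow> real ^ 'N \<Rightarrow> real"
  where "entropic_ot C \<epsilon> \<xi> \<eta> =
    min_over (couplings \<xi> \<eta>) (\<lambda>M. ((1/2) *\<^sub>R C + \<epsilon> *\<^sub>R map_matrix ln M) \<bullet> M)"

end

theory Submission
  imports Defs "HOL-Real_Asymp.Real_Asymp"
begin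

text \<open>
  Writing \<open>\<Gamma> = exp (- C / 2\<epsilon>)\<close>, the transport cost of a plan \<open>M\<close> is \<open>\<epsilon>\<close> times the relative
  entropy of \<open>M\<close> with respect to \<open>\<Gamma>\<close>. Applying the log-sum inequality to every row, with reference
  weights \<open>\<Gamma> r s * exp (u s / \<epsilon>)\<close>, gives weak duality
  \<open>\<epsilon> \<langle>\<mu>, ln \<mu>\<rangle> - \<epsilon> \<langle>\<mu>, ln (\<Gamma> exp (u / \<epsilon>))\<rangle> + \<langle>u, \<zeta>\<rangle> \<le> OT(\<mu>, \<zeta>)\<close>,
  with equality exactly when \<open>\<zeta>\<close> is the column marginal of the diagonally scaled plan determined
  by \<open>u\<close>. That marginal is, up to the factor \<open>\<epsilon>\<close>, the gradient of \<open>\<langle>\<mu>, ln (\<Gamma> exp (u / \<epsilon>))\<rangle>\<close>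
  in \<open>u\<close>, so the first-order condition of the constrained dual problem says that the \<open>n\<close> marginals
  coincide. Summing weak duality over \<open>i\<close>, the constraint cancels the linear term, and the common
  marginal is the only point of the simplex at which equality holds.
\<close>

section \<open>Relative entropy and the log-sum inequality with its equality case\<close>

text \<open>This is \<open>ln t \<le> t - 1\<close> at \<open>t = y / x\<close>, multiplied by
  \<open>x\<close>; equality forces \<open>t = 1\<close>. At \<open>x = 0\<close> the expression is
  just \<open>y\<close>, which is positive, so equality cannot occur there.\<close>

lemma relative_entropy_pos:
  fixes x y :: real
  assumes "0 \<le> x" "0 < y"
  shows "0 \<le> x * ln x - x * ln y - x + y"
    and "x * ln x - x * ln y - x + y = 0 \<Longrightarrow> x = y"
proof -
  show "0 \<le> x * ln x - x * ln y - x + y"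
  proof (cases "x = 0")
    case False
    with assms have "x > 0" by simp
    have "ln (y / x) \<le> y / x - 1"
      using \<open>x > 0\<close> assms by (intro ln_le_minus_one) simp
    then have "x * (ln y - ln x) \<le> x * (y / x - 1)"
      using \<open>x > 0\<close> assms by (simp add: ln_div)
    then show ?thesis
      using \<open>x > 0\<close> by (simp add: algebra_simps)
  qed (use assms in simp)
next
  assume eq: "x * ln x - x * ln y - x + y = 0"
  with assms have "x > 0"
    by (cases "x = 0") auto
  have "x * ln (y / x) = x * (y / x - 1)"
    using \<open>x > 0\<close> assms eq by (simp add: ln_div algebra_simps)
  then have "ln (y / x) = y / x - 1"
    using \<open>x > 0\<close> by simp
  then have "y / x = 1"
    using \<open>x > 0\<close> assms by (intro ln_eq_minus_one) simp_all
  then show "x = y" by simp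
qed

lemma log_sum_inequality:
  fixes x K :: "'a::finite \<Rightarrow> real"
  assumes x: "\<And>s. 0 \<le> x s" and K: "\<And>s. 0 < K s"
  defines "m \<equiv> sum x UNIV" and "S \<equiv> sum K UNIV"
  shows "m * ln m - m * ln S \<le> (\<Sum>s\<in>UNIV. x s * ln (x s) - x s * ln (K s))"
    and "(\<Sum>s\<in>UNIV. x s * ln (x s) - x s * ln (K s)) = m * ln m - m * ln S
           \<longleftrightarrow> (\<forall>s. x s = m * K s / S)"
proof -
  let ?L = "\<Sum>s\<in>UNIV. x s * ln (x s) - x s * ln (K s)"
  have "S > 0"
    unfolding S_def using K by (intro sum_pos) auto
  have "m * ln m - m * ln S \<le> ?L \<and>
    (?L = m * ln m - m * ln S \<longleftrightarrow> (\<forall>s. x s = m * K s / S))"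
  proof (cases "m = 0")
    \<comment> \<open>With zero total mass the comparison weights below would not be positive. Here
      every \<open>x s\<close> vanishes and both claims are trivial.\<close>
    case True
    then have "x s = 0" for s
      using x by (simp add: m_def sum_nonneg_eq_0_iff)
    then show ?thesis
      using True by simp
  next
    case False
    then have "m > 0"
      using x by (simp add: m_def sum_nonneg order_less_le)
    \<comment> \<open>\<open>y\<close> is the multiple of \<open>K\<close> with the same total mass
      as \<open>x\<close>. The linear terms of the entropies \<open>g s\<close> therefore cancel in
      the sum, which is exactly the gap in the inequality; being a sum of nonnegative terms, it
      vanishes only if all of them do.\<close>
    define y where "y s = m * K s / S" for s
    define g where "g s = x s * ln (x s) - x s * ln (y s) - x s + y s" for s
    have y: "y s > 0" for s
      using \<open>m > 0\<close> \<open>S > 0\<close> K by (simp add: y_def)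
    have "sum y UNIV = m"
      using \<open>S > 0\<close> unfolding y_def
      by (simp flip: sum_divide_distrib sum_distrib_left add: S_def)
    have ln_y: "ln (y s) = ln m + ln (K s) - ln S" for s
      using \<open>m > 0\<close> \<open>S > 0\<close> K[of s] by (simp add: y_def ln_div ln_mult)
    have "g s = (x s * ln (x s) - x s * ln (K s)) - x s * (ln m - ln S) - x s + y s" for s
      unfolding g_def ln_y by (simp add: algebra_simps)
    then have "sum g UNIV = ?L - m * (ln m - ln S) - m + sum y UNIV"
      by (simp add: sum.distrib sum_subtractf m_def sum_distrib_right)
    then have sum_g: "sum g UNIV = ?L - (m * ln m - m * ln S)"
      using \<open>sum y UNIV = m\<close> by (simp add: algebra_simps)
    have g: "0 \<le> g s" and g0: "g s = 0 \<longleftrightarrow> x s = y s" for s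
      using relative_entropy_pos[OF x y, of s s] by (auto simp: g_def)
    have "0 \<le> sum g UNIV"
      using g by (simp add: sum_nonneg)
    moreover have "sum g UNIV = 0 \<longleftrightarrow> (\<forall>s. x s = y s)"
      using g g0 by (simp add: sum_nonneg_eq_0_iff)
    ultimately show ?thesis
      unfolding sum_g y_def by auto
  qed
  then show "m * ln m - m * ln S \<le> ?L"
    and "?L = m * ln m - m * ln S \<longleftrightarrow> (\<forall>s. x s = m * K s / S)"
    by blast+
qed

section \<open>Couplings and attainment of the transport minimum\<close>

lemma couplings_eq:
  fixes \<xi> \<eta> :: "real ^ 'N::finite"
  shows "couplings \<xi> \<eta> =
    {M. (\<forall>r s. 0 \<le> M $ r $ s) \<and> (\<forall>r. (\<Sum>s\<in>UNIV. M $ r $ s) = \<xi> $ r)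
      \<and> (\<forall>s. (\<Sum>r\<in>UNIV. M $ r $ s) = \<eta> $ s)}"
  by (simp add: couplings_def less_eq_vec_def vec_eq_iff matrix_vector_mult_def transpose_def)

lemma prob_simplex_iff:
  "x \<in> prob_simplex \<longleftrightarrow> (\<forall>i. 0 \<le> x $ i) \<and> (\<Sum>i\<in>UNIV. x $ i) = 1"
  by (simp add: prob_simplex_def less_eq_vec_def inner_vec_def)

text \<open>Plans may have zero entries, so continuity is needed up to the boundary; at 0 it rests
  on the limit \<open>x * ln x\<close> to 0 from the right.\<close>

lemma continuous_on_mult_ln: "continuous_on {0..} (\<lambda>x::real. x * ln x)"
proof (rule continuous_on_eq_continuous_within[THEN iffD2], rule ballI)
  fix x :: real assume "x \<in> {0..}"
  show "continuous (at x within {0..}) (\<lambda>x. x * ln x)"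
  proof (cases "x = 0")
    case True
    have "((\<lambda>x::real. x * ln x) \<longlongrightarrow> 0) (at_right 0)"
      by real_asymp
    then show ?thesis
      using True by (simp add: continuous_within at_within_Ici_at_right)
  next
    case False
    with \<open>x \<in> {0..}\<close> show ?thesis
      by (intro continuous_intros continuous_ident) (auto simp: continuous_ident)
  qed
qed

definition plan_cost :: "real ^ 'N ^ 'N \<Rightarrow> real \<Rightarrow> real ^ 'N ^ 'N \<Rightarrow> real"
  where "plan_cost C \<epsilon> M = ((1/2) *\<^sub>R C + \<epsilon> *\<^sub>R map_matrix ln M) \<bullet> M"

lemma plan_cost_eq:
  "plan_cost C \<epsilon> M = (\<Sum>r\<in>UNIV. \<Sum>s\<in>UNIV. C $ r $ s / 2 * M $ r $ s + \<epsilon> * (M $ r $ s * ln (M $ r $ s)))"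
  by (simp add: plan_cost_def inner_vec_def map_matrix_def algebra_simps)

text \<open>By nonnegativity the entrywise l1 norm of a coupling is its total mass, which the first
  marginal fixes; this bounds the set.\<close>

lemma compact_couplings: "compact (couplings \<xi> \<eta> :: (real ^ 'N::finite ^ 'N) set)"
proof (rule compact_eq_bounded_closed[THEN iffD2], rule conjI)
  have "norm M \<le> (\<Sum>r\<in>UNIV. \<xi> $ r)" if "M \<in> couplings \<xi> \<eta>" for M :: "real ^ 'N ^ 'N"
  proof -
    have "norm M \<le> (\<Sum>r\<in>UNIV. norm (M $ r))"
      by (simp add: norm_vec_def L2_set_le_sum)
    also have "\<dots> \<le> (\<Sum>r\<in>UNIV. \<Sum>s\<in>UNIV. \<bar>M $ r $ s\<bar>)"
      by (intro sum_mono norm_le_l1_cart)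
    also have "\<dots> = (\<Sum>r\<in>UNIV. \<xi> $ r)"
      using that by (simp add: couplings_eq)
    finally show ?thesis .
  qed
  then show "bounded (couplings \<xi> \<eta> :: (real ^ 'N ^ 'N) set)"
    by (auto simp: bounded_iff)
  show "closed (couplings \<xi> \<eta> :: (real ^ 'N ^ 'N) set)"
    unfolding couplings_eq
    by (intro closed_Collect_conj closed_Collect_all closed_Collect_le closed_Collect_eq
        continuous_intros)
qed


lemma continuous_on_plan_cost:
  "continuous_on {M. \<forall>r s. 0 \<le> M $ r $ s} (plan_cost C \<epsilon>)"
proof -
  have "continuous_on {M. \<forall>r s. 0 \<le> M $ r $ s} (\<lambda>M::real ^ 'a ^ 'a. M $ r $ s * ln (M $ r $ s))" for r s
    by (rule continuous_on_compose2[OF continuous_on_mult_ln]) (auto intro!: continuous_intros)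
  then show ?thesis
    unfolding plan_cost_eq[abs_def]
    by (intro continuous_on_sum continuous_on_add continuous_on_mult_left continuous_on_component
        continuous_on_id)
qed

lemma min_over_eq:
  assumes "x \<in> S" "\<And>y. y \<in> S \<Longrightarrow> f x \<le> f y"
  shows "min_over S f = f x"
  unfolding min_over_def using assms by (intro Least_equality) auto

lemma entropic_ot_eqI:
  assumes "M \<in> couplings \<xi> \<eta>" "\<And>M'. M' \<in> couplings \<xi> \<eta> \<Longrightarrow> plan_cost C \<epsilon> M \<le> plan_cost C \<epsilon> M'"
  shows "entropic_ot C \<epsilon> \<xi> \<eta> = plan_cost C \<epsilon> M"
  using assms unfolding entropic_ot_def plan_cost_def by (intro min_over_eq)

text \<open>\<open>entropic_ot\<close> is a \<open>LEAST\<close>, so its value is usable only after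
  a minimizer is found. The product coupling gives nonemptiness; compactness and continuity do the
  rest.\<close>

lemma entropic_ot_attained:
  fixes \<xi> \<eta> :: "real ^ 'N::finite"
  assumes "\<xi> \<in> prob_simplex" "\<eta> \<in> prob_simplex"
  obtains M where "M \<in> couplings \<xi> \<eta>" "entropic_ot C \<epsilon> \<xi> \<eta> = plan_cost C \<epsilon> M"
proof -
  have "(\<chi> r s. \<xi> $ r * \<eta> $ s) \<in> couplings \<xi> \<eta>"
    using assms by (simp add: couplings_eq prob_simplex_iff flip: sum_distrib_left sum_distrib_right)
  then have "couplings \<xi> \<eta> \<noteq> {}"
    by blast
  moreover have "continuous_on (couplings \<xi> \<eta>) (plan_cost C \<epsilon>)"
    by (rule continuous_on_subset[OF continuous_on_plan_cost]) (auto simp: couplings_eq)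
  ultimately obtain M where "M \<in> couplings \<xi> \<eta>"
    "\<And>M'. M' \<in> couplings \<xi> \<eta> \<Longrightarrow> plan_cost C \<epsilon> M \<le> plan_cost C \<epsilon> M'"
    using continuous_attains_inf[OF compact_couplings] by blast
  then show thesis
    using that entropic_ot_eqI by blast
qed

section \<open>Diagonally scaled plans and their marginals\<close>

text \<open>The Sinkhorn form \<open>diag a * K * diag b\<close>, with
  \<open>a = \<xi> \<oslash> (K *v b)\<close> chosen so that the row sums are
  \<open>\<xi>\<close>.\<close>

definition scaled_plan :: "real ^ 'N ^ 'N \<Rightarrow> real ^ 'N \<Rightarrow> real ^ 'N \<Rightarrow> real ^ 'N ^ 'N"
  where "scaled_plan K \<xi> b = (\<chi> r s. \<xi> $ r * (K $ r $ s * b $ s) / (K *v b) $ r)"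

text \<open>The column sums of \<open>scaled_plan\<close>, factored so that for symmetric
  \<open>K\<close> this is literally the formula claimed for the minimizer.\<close>

definition scaled_marginal :: "real ^ 'N ^ 'N \<Rightarrow> real ^ 'N \<Rightarrow> real ^ 'N \<Rightarrow> real ^ 'N"
  where "scaled_marginal K \<xi> b = b \<odot> (transpose K *v (\<xi> \<oslash> (K *v b)))"

lemma matrix_vector_mult_pos:
  fixes K :: "real ^ 'N::finite ^ 'N"
  assumes "\<And>r s. 0 < K $ r $ s" "\<And>s. 0 < b $ s"
  shows "0 < (K *v b) $ r"
  unfolding matrix_vector_mult_def using assms by (auto intro!: sum_pos)

lemma scaled_marginal_nth:
  "scaled_marginal K \<xi> b $ s = (\<Sum>r\<in>UNIV. scaled_plan K \<xi> b $ r $ s)"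
  by (simp add: scaled_marginal_def scaled_plan_def vec_divide_def matrix_vector_mult_def
      transpose_def sum_distrib_left algebra_simps)

lemma scaled_plan_coupling:
  assumes "\<And>r s. 0 < K $ r $ s" "\<And>s. 0 < b $ s" "\<And>r. 0 \<le> \<xi> $ r"
  shows "scaled_plan K \<xi> b \<in> couplings \<xi> (scaled_marginal K \<xi> b)"
proof -
  have pos: "0 < (K *v b) $ r" for r
    using assms by (intro matrix_vector_mult_pos)
  have "(\<Sum>s\<in>UNIV. scaled_plan K \<xi> b $ r $ s) = \<xi> $ r * (K *v b) $ r / (K *v b) $ r" for r
    unfolding scaled_plan_def
    by (simp add: matrix_vector_mult_def flip: sum_divide_distrib sum_distrib_left)
  then have "(\<Sum>s\<in>UNIV. scaled_plan K \<xi> b $ r $ s) = \<xi> $ r" for r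
    using pos[of r] by simp
  moreover have "0 \<le> scaled_plan K \<xi> b $ r $ s" for r s
    using pos[of r] assms(1)[of r s] assms(2)[of s] assms(3)[of r] by (simp add: scaled_plan_def)
  ultimately show ?thesis
    by (simp add: couplings_eq scaled_marginal_nth)
qed

text \<open>Both marginals carry the same total mass, by swapping the two sums.\<close>

lemma coupling_prob_simplex:
  assumes "M \<in> couplings \<xi> \<eta>" "\<xi> \<in> prob_simplex"
  shows "\<eta> \<in> prob_simplex"
proof -
  have "(\<Sum>s\<in>UNIV. \<eta> $ s) = (\<Sum>s\<in>UNIV. \<Sum>r\<in>UNIV. M $ r $ s)"
    using assms(1) by (simp add: couplings_eq)
  also have "\<dots> = (\<Sum>r\<in>UNIV. \<Sum>s\<in>UNIV. M $ r $ s)"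
    by (rule sum.swap)
  also have "\<dots> = 1"
    using assms by (simp add: couplings_eq prob_simplex_iff)
  finally have "(\<Sum>s\<in>UNIV. \<eta> $ s) = 1" .
  moreover have "0 \<le> \<eta> $ s" for s
  proof -
    have "0 \<le> (\<Sum>r\<in>UNIV. M $ r $ s)"
      using assms(1) by (intro sum_nonneg) (simp add: couplings_eq)
    then show ?thesis
      using assms(1) by (simp add: couplings_eq)
  qed
  ultimately show ?thesis
    by (simp add: prob_simplex_iff)
qed

section \<open>Weak duality and its equality case\<close>

text \<open>The semi-dual objective without its linear term \<open>u \<bullet> \<eta>\<close>, hence
  independent of the second marginal.\<close>

definition dual_value :: "real ^ 'N ^ 'N \<Rightarrow> real \<Rightarrow> real ^ 'N \<Rightarrow> real ^ 'N \<Rightarrow> real"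
  where "dual_value K \<epsilon> \<xi> u =
    \<epsilon> * (\<xi> \<bullet> map_vec ln \<xi> - \<xi> \<bullet> map_vec ln (K *v map_vec exp ((1 / \<epsilon>) *\<^sub>R u)))"

lemma plan_cost_dual_bound:
  fixes C :: "real ^ 'N::finite ^ 'N"
  assumes "\<epsilon> > 0" and \<Gamma>: "\<Gamma> = map_matrix exp (- (1 / (2 * \<epsilon>)) *\<^sub>R C)"
    and M: "M \<in> couplings \<xi> \<eta>"
  shows "dual_value \<Gamma> \<epsilon> \<xi> u + u \<bullet> \<eta> \<le> plan_cost C \<epsilon> M"
    and "plan_cost C \<epsilon> M = dual_value \<Gamma> \<epsilon> \<xi> u + u \<bullet> \<eta> \<longleftrightarrow>
      M = scaled_plan \<Gamma> \<xi> (map_vec exp ((1 / \<epsilon>) *\<^sub>R u))"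
proof -
  define b where "b = map_vec exp ((1 / \<epsilon>) *\<^sub>R u)"
  define L where "L r = (\<Sum>s\<in>UNIV. M $ r $ s * ln (M $ r $ s) - M $ r $ s * ln (\<Gamma> $ r $ s * b $ s))" for r
  define R where "R r = \<xi> $ r * ln (\<xi> $ r) - \<xi> $ r * ln ((\<Gamma> *v b) $ r)" for r
  have pos: "0 < \<Gamma> $ r $ s" "0 < b $ s" for r s
    by (simp_all add: \<Gamma> b_def map_matrix_def map_vec_def)
  \<comment> \<open>The weights \<open>\<Gamma> $ r $ s * b $ s\<close> absorb both cost and
    potential, so \<open>\<epsilon> * L r\<close> is the cost of row \<open>r\<close> minus its
    share of \<open>u \<bullet> \<eta>\<close>.\<close>
  have "\<epsilon> * ln (\<Gamma> $ r $ s * b $ s) = u $ s - C $ r $ s / 2" for r s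
    using \<open>\<epsilon> > 0\<close> by (simp add: \<Gamma> b_def map_matrix_def map_vec_def field_simps flip: exp_add)
  then have "M $ r $ s * (\<epsilon> * ln (\<Gamma> $ r $ s * b $ s)) = M $ r $ s * (u $ s - C $ r $ s / 2)" for r s
    by simp
  then have "\<epsilon> * L r = (\<Sum>s\<in>UNIV. C $ r $ s / 2 * M $ r $ s + \<epsilon> * (M $ r $ s * ln (M $ r $ s)))
      - (\<Sum>s\<in>UNIV. u $ s * M $ r $ s)" for r
    unfolding L_def sum_distrib_left sum_subtractf[symmetric]
    by (intro sum.cong refl) (simp add: algebra_simps)
  then have "(\<Sum>r\<in>UNIV. \<epsilon> * L r) = plan_cost C \<epsilon> M - (\<Sum>r\<in>UNIV. \<Sum>s\<in>UNIV. u $ s * M $ r $ s)"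
    by (simp add: plan_cost_eq sum_subtractf)
  also have "(\<Sum>r\<in>UNIV. \<Sum>s\<in>UNIV. u $ s * M $ r $ s) = u \<bullet> \<eta>"
    using M by (subst sum.swap) (simp add: couplings_eq inner_vec_def flip: sum_distrib_left)
  finally have cost: "plan_cost C \<epsilon> M = \<epsilon> * (\<Sum>r\<in>UNIV. L r) + u \<bullet> \<eta>"
    by (simp add: sum_distrib_left)
  have dual: "dual_value \<Gamma> \<epsilon> \<xi> u = \<epsilon> * (\<Sum>r\<in>UNIV. R r)"
    by (simp add: dual_value_def R_def b_def inner_vec_def map_vec_def sum_subtractf)
  have row: "(\<Sum>s\<in>UNIV. M $ r $ s) = \<xi> $ r" for r
    using M by (simp add: couplings_eq)
  \<comment> \<open>Log-sum on row \<open>r\<close>: the masses are \<open>\<xi> $ r\<close> and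
    \<open>(\<Gamma> *v b) $ r\<close>, so the lower bound is \<open>R r\<close>, and the
    proportionality in the equality case describes row \<open>r\<close> of the scaled plan.\<close>
  have LR: "R r \<le> L r \<and> (L r = R r \<longleftrightarrow> (\<forall>s. M $ r $ s = scaled_plan \<Gamma> \<xi> b $ r $ s))" for r
    using log_sum_inequality[of "\<lambda>s. M $ r $ s" "\<lambda>s. \<Gamma> $ r $ s * b $ s"] M pos
    by (simp add: couplings_eq L_def R_def scaled_plan_def matrix_vector_mult_def)
  then have "(\<Sum>r\<in>UNIV. R r) \<le> (\<Sum>r\<in>UNIV. L r)"
    by (simp add: sum_mono)
  then show "dual_value \<Gamma> \<epsilon> \<xi> u + u \<bullet> \<eta> \<le> plan_cost C \<epsilon> M"
    using \<open>\<epsilon> > 0\<close> by (simp add: cost dual)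
  have "(\<Sum>r\<in>UNIV. L r) = (\<Sum>r\<in>UNIV. R r) \<longleftrightarrow> (\<Sum>r\<in>UNIV. L r - R r) = 0"
    by (simp add: sum_subtractf)
  also have "\<dots> \<longleftrightarrow> (\<forall>r. L r = R r)"
    using LR by (subst sum_nonneg_eq_0_iff) auto
  finally show "plan_cost C \<epsilon> M = dual_value \<Gamma> \<epsilon> \<xi> u + u \<bullet> \<eta> \<longleftrightarrow>
      M = scaled_plan \<Gamma> \<xi> (map_vec exp ((1 / \<epsilon>) *\<^sub>R u))"
    using LR \<open>\<epsilon> > 0\<close> by (simp add: cost dual b_def vec_eq_iff)
qed

text \<open>The plan-level bound is applied to a minimizer. If it is tight, the minimizer is the
  scaled plan, whose column sums are then \<open>\<eta>\<close>. Conversely, if the scaled plan is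
  admissible, it attains a bound valid for all couplings and is optimal.\<close>

lemma entropic_ot_dual_bound:
  fixes C :: "real ^ 'N::finite ^ 'N"
  assumes "\<epsilon> > 0" and \<Gamma>: "\<Gamma> = map_matrix exp (- (1 / (2 * \<epsilon>)) *\<^sub>R C)"
    and \<xi>: "\<xi> \<in> prob_simplex" and \<eta>: "\<eta> \<in> prob_simplex"
  shows "dual_value \<Gamma> \<epsilon> \<xi> u + u \<bullet> \<eta> \<le> entropic_ot C \<epsilon> \<xi> \<eta>"
    and "entropic_ot C \<epsilon> \<xi> \<eta> = dual_value \<Gamma> \<epsilon> \<xi> u + u \<bullet> \<eta> \<longleftrightarrow>
      \<eta> = scaled_marginal \<Gamma> \<xi> (map_vec exp ((1 / \<epsilon>) *\<^sub>R u))"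
proof -
  let ?b = "map_vec exp ((1 / \<epsilon>) *\<^sub>R u)"
  note bound = plan_cost_dual_bound[OF \<open>\<epsilon> > 0\<close> \<Gamma>]
  obtain M where M: "M \<in> couplings \<xi> \<eta>" "entropic_ot C \<epsilon> \<xi> \<eta> = plan_cost C \<epsilon> M"
    using entropic_ot_attained[OF \<xi> \<eta>] .
  show "dual_value \<Gamma> \<epsilon> \<xi> u + u \<bullet> \<eta> \<le> entropic_ot C \<epsilon> \<xi> \<eta>"
    using bound(1)[OF M(1)] M(2) by simp
  have plan: "scaled_plan \<Gamma> \<xi> ?b \<in> couplings \<xi> (scaled_marginal \<Gamma> \<xi> ?b)"
    using \<xi> by (intro scaled_plan_coupling)
      (simp_all add: \<Gamma> map_matrix_def map_vec_def prob_simplex_iff)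
  show "entropic_ot C \<epsilon> \<xi> \<eta> = dual_value \<Gamma> \<epsilon> \<xi> u + u \<bullet> \<eta> \<longleftrightarrow> \<eta> = scaled_marginal \<Gamma> \<xi> ?b"
  proof
    assume "entropic_ot C \<epsilon> \<xi> \<eta> = dual_value \<Gamma> \<epsilon> \<xi> u + u \<bullet> \<eta>"
    then have "M = scaled_plan \<Gamma> \<xi> ?b"
      using bound(2)[OF M(1)] M(2) by simp
    then show "\<eta> = scaled_marginal \<Gamma> \<xi> ?b"
      using M(1) by (simp add: vec_eq_iff couplings_eq scaled_marginal_nth)
  next
    assume \<eta>_eq: "\<eta> = scaled_marginal \<Gamma> \<xi> ?b"
    have "plan_cost C \<epsilon> (scaled_plan \<Gamma> \<xi> ?b) = dual_value \<Gamma> \<epsilon> \<xi> u + u \<bullet> \<eta>"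
      using bound(2)[OF plan] \<eta>_eq by simp
    then show "entropic_ot C \<epsilon> \<xi> \<eta> = dual_value \<Gamma> \<epsilon> \<xi> u + u \<bullet> \<eta>"
      using entropic_ot_eqI[of "scaled_plan \<Gamma> \<xi> ?b" \<xi> \<eta> C \<epsilon>] plan bound(1) \<eta>_eq by simp
  qed
qed

section \<open>First-order condition of the constrained dual problem\<close>

lemma has_derivative_log_partition:
  fixes K :: "real ^ 'N::finite ^ 'N"
  assumes "\<And>r s. 0 < K $ r $ s"
  shows "((\<lambda>t. \<xi> \<bullet> map_vec ln (K *v map_vec exp ((1 / \<epsilon>) *\<^sub>R (u + t *\<^sub>R h))))
    has_real_derivative (1 / \<epsilon>) * (h \<bullet> scaled_marginal K \<xi> (map_vec exp ((1 / \<epsilon>) *\<^sub>R u)))) (at 0)"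
proof -
  define b where "b = map_vec exp ((1 / \<epsilon>) *\<^sub>R u)"
  have pos: "0 < (K *v b) $ r" for r
    using assms by (intro matrix_vector_mult_pos) (simp_all add: b_def map_vec_def)
  have Kb: "(K *v b) $ r = (\<Sum>s\<in>UNIV. K $ r $ s * exp (u $ s / \<epsilon>))" for r
    by (simp add: b_def matrix_vector_mult_def map_vec_def)
  have "((\<lambda>t. \<Sum>r\<in>UNIV. \<xi> $ r * ln (\<Sum>s\<in>UNIV. K $ r $ s * exp ((u $ s + t * h $ s) / \<epsilon>)))
    has_real_derivative
      (\<Sum>r\<in>UNIV. \<xi> $ r * ((\<Sum>s\<in>UNIV. K $ r $ s * (exp (u $ s / \<epsilon>) * (h $ s / \<epsilon>))) / (K *v b) $ r))) (at 0)"
    using pos by (auto intro!: derivative_eq_intros simp: Kb divide_inverse ac_simps)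
  \<comment> \<open>The quotients from the chain rule are entries of the scaled plan weighted by
    \<open>h $ s / \<epsilon>\<close>; swapping the sums then produces its column sums.\<close>
  also have "(\<Sum>r\<in>UNIV. \<xi> $ r * ((\<Sum>s\<in>UNIV. K $ r $ s * (exp (u $ s / \<epsilon>) * (h $ s / \<epsilon>))) / (K *v b) $ r))
      = (\<Sum>r\<in>UNIV. \<Sum>s\<in>UNIV. (1 / \<epsilon>) * (h $ s * scaled_plan K \<xi> b $ r $ s))"
    by (simp add: scaled_plan_def b_def map_vec_def sum_distrib_left sum_divide_distrib ac_simps)
  also have "\<dots> = (1 / \<epsilon>) * (h \<bullet> scaled_marginal K \<xi> b)"
    by (subst sum.swap) (simp add: inner_vec_def scaled_marginal_nth flip: sum_distrib_left sum_divide_distrib)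
  finally show ?thesis
    by (simp add: b_def inner_vec_def map_vec_def matrix_vector_mult_def)
qed

lemma constrained_min_equal_marginals:
  fixes K :: "real ^ 'N::finite ^ 'N" and \<mu> u :: "'n::finite \<Rightarrow> real ^ 'N"
  assumes K: "\<And>r s. 0 < K $ r $ s" and "\<epsilon> > 0"
    and min: "is_arg_min
      (\<lambda>u. \<Sum>i\<in>UNIV. \<mu> i \<bullet> map_vec ln (K *v map_vec exp ((1 / \<epsilon>) *\<^sub>R u i)))
      (\<lambda>u. (\<Sum>i\<in>UNIV. u i) = c) u"
  shows "scaled_marginal K (\<mu> i) (map_vec exp ((1 / \<epsilon>) *\<^sub>R u i)) =
    scaled_marginal K (\<mu> j) (map_vec exp ((1 / \<epsilon>) *\<^sub>R u j))"
proof (cases "i = j")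
  case False
  define m where "m i = scaled_marginal K (\<mu> i) (map_vec exp ((1 / \<epsilon>) *\<^sub>R u i))" for i
  \<comment> \<open>This direction changes only \<open>u i\<close> and \<open>u j\<close>, by
    opposite amounts, so the constraint is preserved. Its size is the marginal difference itself,
    which makes the derivative of \<open>f\<close> at 0 equal to the squared norm of
    \<open>m i - m j\<close> divided by \<open>\<epsilon>\<close>.\<close>
  define d where "d k = (if k = i then m i - m j else if k = j then m j - m i else 0)" for k
  define f where "f t = (\<Sum>k\<in>UNIV. \<mu> k \<bullet> map_vec ln (K *v map_vec exp ((1 / \<epsilon>) *\<^sub>R (u k + t *\<^sub>R d k))))" for t
  have sum_ij: "(\<Sum>k\<in>UNIV. g k) = g i + g j" if "\<And>k. k \<noteq> i \<Longrightarrow> k \<noteq> j \<Longrightarrow> g k = 0"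
    for g :: "'n \<Rightarrow> 'b::comm_monoid_add"
    using that False by (subst sum.mono_neutral_right[of _ "{i, j}"]) auto
  have "(\<Sum>k\<in>UNIV. t *\<^sub>R d k) = 0" for t
    using False by (subst sum_ij) (auto simp: d_def simp flip: scaleR_add_right)
  then have "(\<Sum>k\<in>UNIV. u k + t *\<^sub>R d k) = c" for t
    using min by (simp add: sum.distrib is_arg_min_def)
  then have "f 0 \<le> f t" for t
    using min by (auto simp: f_def is_arg_min_linorder)
  moreover have "(f has_real_derivative (\<Sum>k\<in>UNIV. (1 / \<epsilon>) * (d k \<bullet> m k))) (at 0)"
    unfolding f_def m_def by (intro DERIV_sum has_derivative_log_partition K)
  \<comment> \<open>\<open>f\<close> is minimal at 0 on the whole line, so the neighbourhood radius
    1 is arbitrary.\<close>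
  ultimately have "(\<Sum>k\<in>UNIV. (1 / \<epsilon>) * (d k \<bullet> m k)) = 0"
    by (intro DERIV_local_min[of f _ 0 1]) auto
  then have "(1 / \<epsilon>) * ((m i - m j) \<bullet> m i) + (1 / \<epsilon>) * ((m j - m i) \<bullet> m j) = 0"
    using False by (subst (asm) sum_ij) (auto simp: d_def)
  then have "(1 / \<epsilon>) * ((m i - m j) \<bullet> (m i - m j)) = 0"
    by (simp add: algebra_simps inner_commute)
  then show ?thesis
    using \<open>\<epsilon> > 0\<close> by (simp add: m_def)
qed simp

theorem theorem1:
  fixes \<alpha> \<epsilon> :: real
    and \<theta> :: "'N::finite \<Rightarrow> real ^ 'd::finite"
    and C \<Gamma> :: "real ^ 'N ^ 'N"
    and \<mu> :: "'n::finite \<Rightarrow> real ^ 'N"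
    and \<nu>sum :: "real ^ 'N"
    and uopt :: "'n \<Rightarrow> real ^ 'N"
  assumes "CARD('n) > 1"
    and "\<alpha> > 0" and "\<epsilon> > 0"
    and "C = sq_dist_matrix \<theta>"
    and "\<Gamma> = map_matrix exp (- (1 / (2 * \<epsilon>)) *\<^sub>R C)"
    and "\<And>i. \<mu> i \<in> prob_simplex"
    and "is_arg_min
           (\<lambda>u. \<Sum>i\<in>UNIV. \<mu> i \<bullet> map_vec ln (\<Gamma> *v map_vec exp ((1 / \<epsilon>) *\<^sub>R u i)))
           (\<lambda>u. (\<Sum>i\<in>UNIV. u i) = (2 / \<alpha>) *\<^sub>R \<nu>sum)
           uopt"
  shows "\<exists>\<zeta>plus \<in> prob_simplex.
           (\<forall>\<zeta>. is_arg_min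
                  (\<lambda>\<zeta>. (\<Sum>i\<in>UNIV. entropic_ot C \<epsilon> (\<mu> i) \<zeta>) - (2 / \<alpha>) * (\<nu>sum \<bullet> \<zeta>))
                  (\<lambda>\<zeta>. \<zeta> \<in> prob_simplex) \<zeta>
                \<longleftrightarrow> \<zeta> = \<zeta>plus) \<and>
           (\<forall>i. \<zeta>plus =
                  map_vec exp ((1 / \<epsilon>) *\<^sub>R uopt i) \<odot>
                  (\<Gamma> *v (\<mu> i \<oslash> (\<Gamma> *v map_vec exp ((1 / \<epsilon>) *\<^sub>R uopt i)))))"
proof -
  define m where "m i = scaled_marginal \<Gamma> (\<mu> i) (map_vec exp ((1 / \<epsilon>) *\<^sub>R uopt i))" for i
  define J where "J \<zeta> = (\<Sum>i\<in>UNIV. entropic_ot C \<epsilon> (\<mu> i) \<zeta>) - (2 / \<alpha>) * (\<nu>sum \<bullet> \<zeta>)" for \<zeta>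
  \<comment> \<open>The dual value at \<open>uopt\<close>, which turns out to be the minimum of
    \<open>J\<close> over the simplex.\<close>
  define D where "D = (\<Sum>i\<in>UNIV. dual_value \<Gamma> \<epsilon> (\<mu> i) (uopt i))"
  have \<Gamma>_pos: "0 < \<Gamma> $ r $ s" for r s
    by (simp add: assms(5) map_matrix_def)
  \<comment> \<open>Distances are symmetric; this removes the transpose from
    \<open>scaled_marginal\<close>.\<close>
  have "transpose \<Gamma> = \<Gamma>"
    by (simp add: assms(4,5) map_matrix_def sq_dist_matrix_def transpose_def vec_eq_iff norm_minus_commute)
  then have m_eq: "m i = map_vec exp ((1 / \<epsilon>) *\<^sub>R uopt i) \<odot>
      (\<Gamma> *v (\<mu> i \<oslash> (\<Gamma> *v map_vec exp ((1 / \<epsilon>) *\<^sub>R uopt i))))" for i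
    by (simp add: m_def scaled_marginal_def)
  obtain \<zeta>plus where m: "m i = \<zeta>plus" for i
    using constrained_min_equal_marginals[OF \<Gamma>_pos \<open>\<epsilon> > 0\<close> assms(7)] unfolding m_def by metis
  have "m i \<in> prob_simplex" for i
    unfolding m_def
    by (rule coupling_prob_simplex[OF scaled_plan_coupling assms(6)])
      (use \<Gamma>_pos assms(6) in \<open>simp_all add: map_vec_def prob_simplex_iff\<close>)
  then have \<zeta>plus: "\<zeta>plus \<in> prob_simplex"
    using m by simp
  \<comment> \<open>The constraint on \<open>uopt\<close> splits the linear term among the indices,
    so that \<open>J \<zeta> - D\<close> becomes a sum of duality gaps.\<close>
  have "(2 / \<alpha>) * (\<nu>sum \<bullet> \<zeta>) = (\<Sum>i\<in>UNIV. uopt i \<bullet> \<zeta>)" for \<zeta>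
    using assms(7) unfolding is_arg_min_def
    by (metis inner_scaleR_left inner_sum_left)
  then have J_D: "J \<zeta> - D =
      (\<Sum>i\<in>UNIV. entropic_ot C \<epsilon> (\<mu> i) \<zeta> - (dual_value \<Gamma> \<epsilon> (\<mu> i) (uopt i) + uopt i \<bullet> \<zeta>))" for \<zeta>
    by (simp add: J_def D_def sum_subtractf sum.distrib)
  note bound = entropic_ot_dual_bound[OF \<open>\<epsilon> > 0\<close> assms(5) assms(6)]
  have J_ge: "D \<le> J \<zeta>" and J_iff: "J \<zeta> = D \<longleftrightarrow> \<zeta> = \<zeta>plus" if "\<zeta> \<in> prob_simplex" for \<zeta>
  proof -
    have "0 \<le> J \<zeta> - D"
      unfolding J_D using bound(1)[OF that] by (intro sum_nonneg) simp
    then show "D \<le> J \<zeta>" by simp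
    \<comment> \<open>All gaps are nonnegative, so the sum vanishes only if each does, that is, if
      \<open>\<zeta>\<close> equals every marginal \<open>m i\<close>.\<close>
    have "J \<zeta> - D = 0 \<longleftrightarrow> (\<forall>i. \<zeta> = m i)"
      unfolding J_D using bound[OF that] by (subst sum_nonneg_eq_0_iff) (auto simp: m_def)
    then show "J \<zeta> = D \<longleftrightarrow> \<zeta> = \<zeta>plus"
      by (simp add: m)
  qed
  \<comment> \<open>\<open>D\<close> is a lower bound of \<open>J\<close> on the simplex, attained
    at \<open>\<zeta>plus\<close> and nowhere else; this gives existence and uniqueness
    together.\<close>
  have "is_arg_min J (\<lambda>\<zeta>. \<zeta> \<in> prob_simplex) \<zeta> \<longleftrightarrow> \<zeta> = \<zeta>plus" for \<zeta>
    unfolding is_arg_min_linorder using J_ge J_iff \<zeta>plus by (metis order_antisym)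
  then show ?thesis
    using \<zeta>plus m_eq unfolding m J_def[abs_def] by (intro bexI[of _ \<zeta>plus]) simp_all
qed

end
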